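(* Let $X$ be a normed space, let $f$ be a modulus function and let $\theta=(k_r)$ be a lacunary sequence. (1) If $S_\theta=S_\theta^f$, then $f$ must be $\theta$-compatible. (2) If $N_\theta=N_\theta^f$, then $f$ must be $\theta$-compatible.
   Context: A modulus function is a function $f:\mathbb{R}^+\to\mathbb{R}^+$ (with $\mathbb{R}^+=[0,\infty)$) such that: (1) $f(x)=0$ if and only if $x=0$; (2) $f(x+y)\le f(x)+f(y)$ for all $x,y\in\mathbb{R}^+$; (3) $f$ is increasing; (4) $f$ is continuous from the right at $0$. All modulus functions are assumed to be unbounded. A lacunary sequence is an increasing sequence $\theta=(k_r)_{r\ge 0}$ of natural numbers with $k_0=0$ such that $h_r:=k_r-k_{r-1}\to\infty$ as $r\to\infty$. Put $I_r=(k_{r-1},k_r]$ for $r\ge1$ (indices $k\in I_r$ are natural numbers). The modulus function $f$ is $\theta$-compatible if $\lim_{\varepsilon\to0}\varphi_\theta(\varepsilon)=0$, where $\varphi_\theta(\varepsilon)=\limsup_{r\to\infty}\frac{f(h_r\varepsilon)}{f(h_r)}$ for $\varepsilon>0$. For a normed space $(X,\|\cdot\|)$, with $\#$ denoting cardinality: - $S_\theta$ (lacunary statistically convergent sequences) is the set of sequences $(x_n)$ in $X$ for which there is $L\in X$ such that for every $\varepsilon>0$, $\lim_{r\to\infty}\frac{1}{h_r}\#\{k\in I_r:\|x_k-L\|>\varepsilon\}=0$. - $S_\theta^f$ (lacunary $f$-statistically convergent sequences) is the set of sequences $(x_n)$ in $X$ for which there is $L\in X$ such that for every $\varepsilon>0$,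 $\lim_{r\to\infty}\frac{1}{f(h_r)}f\left(\#\{k\in I_r:\|x_k-L\|>\varepsilon\}\right)=0$. - $N_\theta$ (lacunary strong Cesàro convergent sequences) is the set of sequences $(x_n)$ in $X$ for which there is $L\in X$ with $\lim_{r\to\infty}\frac{1}{h_r}\sum_{k\in I_r}\|x_k-L\|=0$. - $N_\theta^f$ (lacunary $f$-strong Cesàro convergent sequences) is the set of sequences $(x_n)$ in $X$ for which there is $L\in X$ with $\lim_{r\to\infty}\frac{1}{f(h_r)}f\left(\sum_{k\in I_r}\|x_k-L\|\right)=0$.
   Formalization: The normed space X is assumed to be nonzero: for X = {0} all four sets consist of all sequences, so both equalities hold for every f, although f(x) = log(1+x) is not θ-compatible. *)

theory Defs
  imports "HOL-Analysis.Analysis"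
begin

text \<open>
  Modulus functions map \<open>[0,\<infinity>)\<close> to itself; they are represented by functions on \<^typ>\<open>real\<close>
  whose values at negative arguments are unconstrained and never used.
  ``Increasing'' is meant in the weak sense.
\<close>

definition modulus_function :: "(real \<Rightarrow> real) \<Rightarrow> bool" where
  "modulus_function f \<longleftrightarrow>
     (\<forall>x\<ge>0. f x \<ge> 0) \<and>
     (\<forall>x\<ge>0. f x = 0 \<longleftrightarrow> x = 0) \<and>
     (\<forall>x\<ge>0. \<forall>y\<ge>0. f (x + y) \<le> f x + f y) \<and>
     mono_on {0..} f \<and>
     continuous (at_right 0) f"

definition unbounded_modulus :: "(real \<Rightarrow> real) \<Rightarrow> bool" where
  "unbounded_modulus f \<longleftrightarrow> modulus_function f \<and> \<not> bounded (f ` {0..})"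

text \<open>
  \<open>lac_h \<theta> r\<close> and \<open>lac_I \<theta> r\<close> are meaningful for \<open>r \<ge> 1\<close>; at \<open>r = 0\<close> truncated subtraction gives
  \<open>0\<close> and \<open>{}\<close>, which has no influence on limits as \<open>r \<rightarrow> \<infinity>\<close>.
\<close>

definition lac_h :: "(nat \<Rightarrow> nat) \<Rightarrow> nat \<Rightarrow> nat" where
  "lac_h \<theta> r = \<theta> r - \<theta> (r - 1)"

definition lac_I :: "(nat \<Rightarrow> nat) \<Rightarrow> nat \<Rightarrow> nat set" where
  "lac_I \<theta> r = {\<theta> (r - 1)<..\<theta> r}"

definition lacunary :: "(nat \<Rightarrow> nat) \<Rightarrow> bool" where
  "lacunary \<theta> \<longleftrightarrow> strict_mono \<theta> \<and> \<theta> 0 = 0 \<and> filterlim (lac_h \<theta>) at_top sequentially"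

definition lac_phi :: "(nat \<Rightarrow> nat) \<Rightarrow> (real \<Rightarrow> real) \<Rightarrow> real \<Rightarrow> ereal" where
  "lac_phi \<theta> f \<epsilon> = limsup (\<lambda>r. ereal (f (real (lac_h \<theta> r) * \<epsilon>) / f (real (lac_h \<theta> r))))"

definition lac_compatible :: "(nat \<Rightarrow> nat) \<Rightarrow> (real \<Rightarrow> real) \<Rightarrow> bool" where
  "lac_compatible \<theta> f \<longleftrightarrow> (lac_phi \<theta> f \<longlongrightarrow> 0) (at_right 0)"

text \<open>
  Sequences are functions on \<^typ>\<open>nat\<close>; the entry at index \<open>0\<close> lies in no \<open>lac_I \<theta> r\<close>, so
  the sets below do not depend on whether sequences start at \<open>0\<close> or \<open>1\<close>.
\<close>

definition S_lac :: "(nat \<Rightarrow> nat) \<Rightarrow> (nat \<Rightarrow> 'a::real_normed_vector) set" where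
  "S_lac \<theta> = {x. \<exists>L. \<forall>\<epsilon>>0.
     (\<lambda>r. 1 / real (lac_h \<theta> r) * real (card {k \<in> lac_I \<theta> r. norm (x k - L) > \<epsilon>}))
       \<longlonglongrightarrow> 0}"

definition S_lac_mod ::
    "(nat \<Rightarrow> nat) \<Rightarrow> (real \<Rightarrow> real) \<Rightarrow> (nat \<Rightarrow> 'a::real_normed_vector) set" where
  "S_lac_mod \<theta> f = {x. \<exists>L. \<forall>\<epsilon>>0.
     (\<lambda>r. 1 / f (real (lac_h \<theta> r)) * f (real (card {k \<in> lac_I \<theta> r. norm (x k - L) > \<epsilon>})))
       \<longlonglongrightarrow> 0}"

definition N_lac :: "(nat \<Rightarrow> nat) \<Rightarrow> (nat \<Rightarrow> 'a::real_normed_vector) set" where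
  "N_lac \<theta> = {x. \<exists>L.
     (\<lambda>r. 1 / real (lac_h \<theta> r) * (\<Sum>k\<in>lac_I \<theta> r. norm (x k - L))) \<longlonglongrightarrow> 0}"

definition N_lac_mod ::
    "(nat \<Rightarrow> nat) \<Rightarrow> (real \<Rightarrow> real) \<Rightarrow> (nat \<Rightarrow> 'a::real_normed_vector) set" where
  "N_lac_mod \<theta> f = {x. \<exists>L.
     (\<lambda>r. 1 / f (real (lac_h \<theta> r)) * f (\<Sum>k\<in>lac_I \<theta> r. norm (x k - L))) \<longlonglongrightarrow> 0}"

end

theory Submission
  imports Defs
begin

text \<open>
  If \<open>f\<close> is not \<open>\<theta>\<close>-compatible, then there are \<open>m r \<le> h\<^sub>r\<close> with \<open>m r / h\<^sub>r \<rightarrow> 0\<close> for which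
  \<open>f (m r) / f h\<^sub>r\<close> does not tend to \<open>0\<close>. A sequence equal to some \<open>v \<noteq> 0\<close> on the first \<open>m r\<close> indices
  of each \<open>I\<^sub>r\<close> and \<open>0\<close> elsewhere is strongly convergent to \<open>0\<close>. It has no \<open>f\<close>-statistical limit:
  \<open>L = 0\<close> is excluded by the choice of \<open>m\<close>, and \<open>L \<noteq> 0\<close> because most entries are \<open>0\<close> and
  \<open>f h \<le> 2 f (h / 2)\<close>. Since strong convergence implies statistical convergence (with and without
  a modulus), this one sequence refutes both equalities.
\<close>

section \<open>Growth of modulus functions\<close>

lemma modulus_functionD:
  assumes "modulus_function f"
  shows modulus_nonneg: "\<And>x. x \<ge> 0 \<Longrightarrow> f x \<ge> 0"
    and modulus_eq_0_iff: "\<And>x. x \<ge> 0 \<Longrightarrow> f x = 0 \<longleftrightarrow> x = 0"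
    and modulus_subadd: "\<And>x y. x \<ge> 0 \<Longrightarrow> y \<ge> 0 \<Longrightarrow> f (x + y) \<le> f x + f y"
    and modulus_mono: "\<And>x y. 0 \<le> x \<Longrightarrow> x \<le> y \<Longrightarrow> f x \<le> f y"
  using assms unfolding modulus_function_def by (auto simp: mono_on_def)

lemma modulus_pos:
  assumes "modulus_function f" "x > 0"
  shows "f x > 0"
  using modulus_nonneg[OF assms(1), of x] modulus_eq_0_iff[OF assms(1), of x] assms(2) by auto

text \<open>Through the identity, convergence without a modulus becomes a special case of
  convergence with one.\<close>

lemma modulus_function_id: "modulus_function (\<lambda>x. x)"
  unfolding modulus_function_def by (auto simp: mono_on_def)

lemma modulus_of_nat_mult_le:
  assumes "modulus_function f" "x \<ge> 0"
  shows "f (real n * x) \<le> real n * f x"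
proof (induction n)
  case 0
  then show ?case using modulus_eq_0_iff[OF assms(1), of 0] by simp
next
  case (Suc n)
  have "f (real (Suc n) * x) \<le> f (real n * x) + f x"
    using modulus_subadd[OF assms(1), of "real n * x" x] assms(2) by (simp add: algebra_simps)
  with Suc show ?case by (simp add: algebra_simps)
qed

text \<open>Subadditivity: \<open>x\<close> is at most \<open>n\<close> copies of
  \<open>s * x\<close> once \<open>n\<close> exceeds \<open>1 / s\<close>. What matters is that
  \<open>K\<close> does not depend on \<open>x\<close>.\<close>

lemma modulus_le_scaled:
  assumes "modulus_function f" "s > 0"
  obtains K where "\<And>x. x \<ge> 0 \<Longrightarrow> f x \<le> K * f (s * x)"
proof -
  obtain n where n: "inverse s < real n"
    using reals_Archimedean2 by blast
  show thesis
  proof (rule that[of "real n"])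
    fix x :: real assume x: "x \<ge> 0"
    have "1 \<le> real n * s" using n \<open>s > 0\<close> by (simp add: field_simps)
    then have "x \<le> real n * (s * x)"
      using mult_right_mono[OF _ x, of 1 "real n * s"] by (simp add: mult.assoc)
    then have "f x \<le> f (real n * (s * x))" by (rule modulus_mono[OF assms(1) x])
    also have "\<dots> \<le> real n * f (s * x)"
      using modulus_of_nat_mult_le[OF assms(1)] assms(2) x by simp
    finally show "f x \<le> real n * f (s * x)" .
  qed
qed

text \<open>A fixed factor \<open>s\<close> costs only a constant factor after applying
  \<open>f\<close>. This serves as the comparison test twice: with \<open>s\<close> the threshold
  \<epsilon> in the step from strong to statistical convergence, and with \<open>s = 1 / 2\<close>
  when a nonzero limit is ruled out.\<close>

lemma modulus_ratio_tendsto_0: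
  fixes t u h :: "nat \<Rightarrow> real"
  assumes f: "modulus_function f" and s: "s > 0"
    and lim: "(\<lambda>r. 1 / f (h r) * f (t r)) \<longlonglongrightarrow> 0"
    and h: "\<And>r. h r \<ge> 0" and u: "\<And>r. u r \<ge> 0"
    and le: "\<forall>\<^sub>F r in sequentially. s * u r \<le> t r"
  shows "(\<lambda>r. 1 / f (h r) * f (u r)) \<longlonglongrightarrow> 0"
proof -
  obtain K where K: "\<And>x. x \<ge> 0 \<Longrightarrow> f x \<le> K * f (s * x)"
    using modulus_le_scaled[OF f s] by blast
  have bound: "1 / f (h r) * f (u r) \<le> \<bar>K\<bar> * (1 / f (h r) * f (t r))" if "s * u r \<le> t r" for r
  proof -
    have su: "0 \<le> s * u r" using s u[of r] by simp
    have "f (u r) \<le> K * f (s * u r)" using K u by blast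
    \<comment> \<open>The sign of \<open>K\<close> is not recorded; the absolute value makes the
      factor nonnegative.\<close>
    also have "\<dots> \<le> \<bar>K\<bar> * f (s * u r)"
      using modulus_nonneg[OF f su] by (intro mult_right_mono) auto
    also have "\<dots> \<le> \<bar>K\<bar> * f (t r)"
      using modulus_mono[OF f su that] by (intro mult_left_mono) auto
    finally have "1 / f (h r) * f (u r) \<le> 1 / f (h r) * (\<bar>K\<bar> * f (t r))"
      using modulus_nonneg[OF f h[of r]] by (intro mult_left_mono) auto
    then show ?thesis by (simp add: algebra_simps)
  qed
  show ?thesis
  proof (rule tendsto_sandwich[OF _ _ tendsto_const])
    show "\<forall>\<^sub>F r in sequentially. 0 \<le> 1 / f (h r) * f (u r)"
      using modulus_nonneg[OF f] h u by simp
    show "\<forall>\<^sub>F r in sequentially. 1 / f (h r) * f (u r) \<le> \<bar>K\<bar> * (1 / f (h r) * f (t r))"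
      using le by eventually_elim (rule bound)
    show "(\<lambda>r. \<bar>K\<bar> * (1 / f (h r) * f (t r))) \<longlonglongrightarrow> 0"
      using tendsto_mult_left[OF lim, of "\<bar>K\<bar>"] by simp
  qed
qed

section \<open>From strong to statistical convergence\<close>

lemma N_lac_mod_subset_S_lac_mod:
  assumes "modulus_function f"
  shows "N_lac_mod \<theta> f \<subseteq> S_lac_mod \<theta> f"
proof
  fix x :: "nat \<Rightarrow> 'a" assume "x \<in> N_lac_mod \<theta> f"
  then obtain L where L:
    "(\<lambda>r. 1 / f (real (lac_h \<theta> r)) * f (\<Sum>k\<in>lac_I \<theta> r. norm (x k - L))) \<longlonglongrightarrow> 0"
    unfolding N_lac_mod_def by blast
  have "(\<lambda>r. 1 / f (real (lac_h \<theta> r)) * f (real (card {k \<in> lac_I \<theta> r. norm (x k - L) > \<epsilon>})))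
          \<longlonglongrightarrow> 0" if "\<epsilon> > 0" for \<epsilon> :: real
  proof (rule modulus_ratio_tendsto_0[OF assms that L])
    \<comment> \<open>Markov's inequality for the counting measure on
      \<open>lac_I \<theta> r\<close>.\<close>
    have "\<epsilon> * real (card {k \<in> lac_I \<theta> r. norm (x k - L) > \<epsilon>}) \<le> (\<Sum>k\<in>lac_I \<theta> r. norm (x k - L))"
      for r
    proof -
      let ?B = "{k \<in> lac_I \<theta> r. norm (x k - L) > \<epsilon>}"
      have "\<epsilon> * real (card ?B) = (\<Sum>k\<in>?B. \<epsilon>)" by simp
      also have "\<dots> \<le> (\<Sum>k\<in>?B. norm (x k - L))" by (intro sum_mono) auto
      also have "\<dots> \<le> (\<Sum>k\<in>lac_I \<theta> r. norm (x k - L))"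
        by (intro sum_mono2) (auto simp: lac_I_def)
      finally show ?thesis .
    qed
    then show "\<forall>\<^sub>F r in sequentially.
        \<epsilon> * real (card {k \<in> lac_I \<theta> r. norm (x k - L) > \<epsilon>}) \<le> (\<Sum>k\<in>lac_I \<theta> r. norm (x k - L))"
      by simp
  qed auto
  then show "x \<in> S_lac_mod \<theta> f" unfolding S_lac_mod_def by blast
qed

lemma N_lac_subset_S_lac: "N_lac \<theta> \<subseteq> S_lac \<theta>"
  using N_lac_mod_subset_S_lac_mod[OF modulus_function_id, of \<theta>]
  unfolding N_lac_mod_def S_lac_mod_def N_lac_def S_lac_def .

section \<open>Failure of compatibility and the resulting counts\<close>

lemma lac_phi_mono:
  assumes "modulus_function f" "0 \<le> \<delta>" "\<delta> \<le> \<epsilon>"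
  shows "lac_phi \<theta> f \<delta> \<le> lac_phi \<theta> f \<epsilon>"
  unfolding lac_phi_def
proof (intro Limsup_mono always_eventually allI)
  fix r
  show "ereal (f (real (lac_h \<theta> r) * \<delta>) / f (real (lac_h \<theta> r)))
      \<le> ereal (f (real (lac_h \<theta> r) * \<epsilon>) / f (real (lac_h \<theta> r)))"
    unfolding ereal_less_eq
    by (intro divide_right_mono modulus_mono[OF assms(1)] mult_left_mono mult_nonneg_nonneg
        modulus_nonneg[OF assms(1)] of_nat_0_le_iff assms(2,3))
qed

lemma lac_phi_nonneg:
  assumes "modulus_function f" "0 \<le> \<epsilon>"
  shows "0 \<le> lac_phi \<theta> f \<epsilon>"
proof -
  have "0 = limsup (\<lambda>r. 0 :: ereal)" by (simp add: Limsup_const)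
  also have "\<dots> \<le> lac_phi \<theta> f \<epsilon>"
    unfolding lac_phi_def using assms modulus_nonneg[OF assms(1)]
    by (intro Limsup_mono always_eventually allI) auto
  finally show ?thesis .
qed

text \<open>Since \<open>lac_phi \<theta> f\<close> is nonnegative and monotone, it can fail to tend
  to 0 at 0 only by staying above one positive bound for all \<epsilon>. Any positive real
  \<open>c\<close> below that bound is then exceeded infinitely often, by the definition of the
  limit superior.\<close>

lemma not_lac_compatible_frequently:
  assumes f: "modulus_function f" and nc: "\<not> lac_compatible \<theta> f"
  obtains c where "c > 0"
    "\<And>\<epsilon>. \<epsilon> > 0 \<Longrightarrow>
      \<exists>\<^sub>F r in sequentially. c < f (real (lac_h \<theta> r) * \<epsilon>) / f (real (lac_h \<theta> r))"
proof -
  have "\<exists>a>0. \<not> (\<forall>\<^sub>F \<epsilon> in at_right 0. lac_phi \<theta> f \<epsilon> < a)"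
  proof (rule ccontr)
    assume "\<not> ?thesis"
    then have small: "\<forall>\<^sub>F \<epsilon> in at_right 0. lac_phi \<theta> f \<epsilon> < a" if "a > 0" for a
      using that by blast
    have "\<forall>\<^sub>F \<epsilon> in at_right 0. a < lac_phi \<theta> f \<epsilon>" if "a < 0" for a
      using eventually_at_right_less
      by eventually_elim (use lac_phi_nonneg[OF f] that in \<open>auto intro: less_le_trans\<close>)
    then have "lac_compatible \<theta> f"
      unfolding lac_compatible_def using small by (intro order_tendstoI) auto
    with nc show False by simp
  qed
  then obtain a where a: "a > 0" "\<not> (\<forall>\<^sub>F \<epsilon> in at_right 0. lac_phi \<theta> f \<epsilon> < a)" by blast
  \<comment> \<open>A single \<epsilon> violating this would, by monotonicity, put all smaller
    arguments below \<open>a\<close> as well.\<close>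
  have big: "a \<le> lac_phi \<theta> f \<epsilon>" if "\<epsilon> > 0" for \<epsilon>
  proof (rule ccontr)
    assume "\<not> ?thesis"
    then have "lac_phi \<theta> f \<delta> < a" if "0 < \<delta>" "\<delta> < \<epsilon>" for \<delta>
      using lac_phi_mono[OF f, of \<delta> \<epsilon> \<theta>] that by (meson le_less_trans less_imp_le not_le)
    then have "\<forall>\<^sub>F \<delta> in at_right 0. lac_phi \<theta> f \<delta> < a"
      using \<open>\<epsilon> > 0\<close> unfolding eventually_at_right_field by blast
    with a show False by simp
  qed
  \<comment> \<open>The bound \<open>a\<close> is an extended real and may be infinite, so a real
    number is chosen below it.\<close>
  obtain c where c: "0 < ereal c" "ereal c < a"
    using ereal_dense2[OF a(1)] by blast
  show thesis
  proof (rule that[of c])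
    show "c > 0" using c by simp
    fix \<epsilon> :: real assume "\<epsilon> > 0"
    show "\<exists>\<^sub>F r in sequentially. c < f (real (lac_h \<theta> r) * \<epsilon>) / f (real (lac_h \<theta> r))"
    proof (rule ccontr)
      assume "\<not> ?thesis"
      then have "\<forall>\<^sub>F r in sequentially.
          ereal (f (real (lac_h \<theta> r) * \<epsilon>) / f (real (lac_h \<theta> r))) \<le> ereal c"
        by (simp add: not_frequently not_less)
      then have "lac_phi \<theta> f \<epsilon> \<le> ereal c"
        unfolding lac_phi_def by (rule Limsup_bounded)
      with big[OF \<open>\<epsilon> > 0\<close>] c show False by simp
    qed
  qed
qed

text \<open>Recursive choice: each \<open>P (Suc n)\<close> holds at some index beyond the one
  chosen for \<open>P n\<close>.\<close>

lemma frequently_diagonal: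
  fixes P :: "nat \<Rightarrow> nat \<Rightarrow> bool"
  assumes "\<And>n. \<exists>\<^sub>F r in sequentially. P n r"
  obtains g where "strict_mono g" "\<And>n. P n (g n)"
proof -
  have "\<exists>g. \<forall>n. P n (g n) \<and> g n < g (Suc n)"
  proof (rule dependent_nat_choice)
    show "\<exists>r. P 0 r" by (rule frequently_ex[OF assms])
  next
    fix r n
    obtain r' where "r' \<ge> Suc r" "P (Suc n) r'"
      using assms[of "Suc n"] unfolding frequently_sequentially by blast
    then show "\<exists>r'. P (Suc n) r' \<and> r < r'" by auto
  qed
  then show thesis using that by (auto simp: strict_mono_Suc_iff)
qed

lemma filterlim_lac_h:
  assumes "lacunary \<theta>"
  shows "filterlim (\<lambda>r. real (lac_h \<theta> r)) at_top sequentially"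
  using assms unfolding lacunary_def
  by (intro filterlim_compose[OF filterlim_real_sequentially]) auto

lemma not_lac_compatible_imp_counts:
  assumes f: "modulus_function f" and \<theta>: "lacunary \<theta>" and nc: "\<not> lac_compatible \<theta> f"
  obtains m :: "nat \<Rightarrow> nat" where
    "\<And>r. m r \<le> lac_h \<theta> r"
    "(\<lambda>r. 1 / real (lac_h \<theta> r) * real (m r)) \<longlonglongrightarrow> 0"
    "\<not> (\<lambda>r. 1 / f (real (lac_h \<theta> r)) * f (real (m r))) \<longlonglongrightarrow> 0"
proof -
  let ?h = "\<lambda>r. real (lac_h \<theta> r)"
  obtain c where c: "c > 0"
    and freq: "\<And>\<epsilon>. \<epsilon> > 0 \<Longrightarrow> \<exists>\<^sub>F r in sequentially. c < f (?h r * \<epsilon>) / f (?h r)"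
    using not_lac_compatible_frequently[OF f nc] by blast
  define Q where "Q n r \<longleftrightarrow> c < f (?h r * (1 / real (Suc n))) / f (?h r)" for n r
  have "\<exists>\<^sub>F r in sequentially. Q n r" for n
    unfolding Q_def by (rule freq) simp
  then obtain g where g: "strict_mono g"
    and Q: "\<And>n. Q n (g n)"
    using frequently_diagonal[of Q] by blast
  \<comment> \<open>Here \<open>inv g r\<close> recovers the \<open>n\<close> with
    \<open>r = g n\<close>. Rounding up keeps \<open>f (m r)\<close> above the value in
    \<open>Q\<close>, and raises the count by at most 1, which is negligible against
    \<open>lac_h \<theta> r\<close>.\<close>
  define m where "m r = (if r \<in> range g
    then nat \<lceil>?h r * (1 / real (Suc (inv g r)))\<rceil> else 0)" for r
  have inv_g: "inv g (g n) = n" for n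
    using g by (simp add: strict_mono_imp_inj_on)
  have mg: "m (g n) = nat \<lceil>?h (g n) * (1 / real (Suc n))\<rceil>" for n
    by (simp add: m_def inv_g)
  have m_le: "m r \<le> lac_h \<theta> r" for r
  proof -
    have "?h r * (1 / real (Suc n)) \<le> ?h r" for n
      by (simp add: field_simps)
    then show ?thesis by (auto simp: m_def ceiling_le_iff nat_le_iff)
  qed
  have lim: "(\<lambda>r. 1 / ?h r * real (m r)) \<longlonglongrightarrow> 0"
  proof (rule order_tendstoI)
    fix a :: real assume "a < 0"
    then have "a < 1 / ?h r * real (m r)" for r
      by (rule less_le_trans) simp
    then show "\<forall>\<^sub>F r in sequentially. a < 1 / ?h r * real (m r)" by simp
  next
    fix a :: real assume a: "0 < a"
    \<comment> \<open>The bound \<open>a\<close> is split in half: one part for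
      \<open>1 / real (Suc n)\<close>, the other for the rounding error
      \<open>1 / lac_h \<theta> r\<close>.\<close>
    obtain N where N: "1 / real (Suc N) < a / 2"
      using reals_Archimedean[of "a / 2"] a by (auto simp: inverse_eq_divide)
    have "\<forall>\<^sub>F r in sequentially. ?h r > 2 / a"
      using filterlim_lac_h[OF \<theta>] by (simp add: filterlim_at_top_dense)
    moreover have "\<forall>\<^sub>F r in sequentially. r \<ge> g N"
      by (rule eventually_ge_at_top)
    ultimately show "\<forall>\<^sub>F r in sequentially. 1 / ?h r * real (m r) < a"
    proof eventually_elim
      case (elim r)
      have hpos: "?h r > 0" using less_trans[OF _ elim(1), of 0] a by simp
      show ?case
      proof (cases "r \<in> range g")
        case False
        then show ?thesis using a by (simp add: m_def)
      next
        case True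
        then obtain n where n: "r = g n" by blast
        have "N \<le> n" using elim(2) n g by (simp add: strict_mono_less_eq)
        then have "1 / real (Suc n) \<le> 1 / real (Suc N)" by (simp add: field_simps)
        then have q: "1 / real (Suc n) < a / 2" using N by simp
        have "real (m r) \<le> ?h r * (1 / real (Suc n)) + 1"
          unfolding n mg by (simp add: of_nat_nat)
        then have "1 / ?h r * real (m r) \<le> 1 / ?h r * (?h r * (1 / real (Suc n)) + 1)"
          by (intro mult_left_mono) auto
        also have "\<dots> = 1 / real (Suc n) + 1 / ?h r"
          using hpos by (simp add: distrib_left)
        also have "\<dots> < a / 2 + a / 2"
        proof (rule add_strict_mono[OF q])
          show "1 / ?h r < a / 2" using elim(1) hpos a by (simp add: field_simps)
        qed
        finally show ?thesis by simp
      qed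
    qed
  qed
  have "\<not> (\<lambda>r. 1 / f (?h r) * f (real (m r))) \<longlonglongrightarrow> 0"
  proof
    assume "(\<lambda>r. 1 / f (?h r) * f (real (m r))) \<longlonglongrightarrow> 0"
    \<comment> \<open>Along \<open>g\<close> the ratio stays above \<open>c\<close> by
      \<open>Q\<close>, so a limit 0 of the subsequence is impossible.\<close>
    then have "(\<lambda>n. 1 / f (?h (g n)) * f (real (m (g n)))) \<longlonglongrightarrow> 0"
      using LIMSEQ_subseq_LIMSEQ[OF _ g] unfolding o_def by blast
    then have "\<forall>\<^sub>F n in sequentially. 1 / f (?h (g n)) * f (real (m (g n))) < c"
      by (rule order_tendstoD(2)[OF _ c])
    then obtain n where n: "1 / f (?h (g n)) * f (real (m (g n))) < c"
      using eventually_happens'[OF sequentially_bot] by blast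
    have "f (?h (g n) * (1 / real (Suc n))) \<le> f (real (m (g n)))"
      by (intro modulus_mono[OF f]) (auto simp: mg real_nat_ceiling_ge simp del: of_nat_Suc)
    then have "f (?h (g n) * (1 / real (Suc n))) / f (?h (g n))
        \<le> f (real (m (g n))) / f (?h (g n))"
      using modulus_nonneg[OF f] by (intro divide_right_mono) auto
    with Q[of n] n show False by (simp add: Q_def)
  qed
  with m_le lim show thesis by (rule that)
qed

section \<open>The separating sequence\<close>

lemma card_lac_I: "card (lac_I \<theta> r) = lac_h \<theta> r"
  by (simp add: lac_I_def lac_h_def)

text \<open>The intervals are pairwise disjoint, so the counts can be prescribed independently:
  \<open>A\<close> is the union of initial segments of length \<open>m r\<close>.\<close>

lemma ex_set_lac_I_counts:
  assumes \<theta>: "lacunary \<theta>" and m: "\<And>r. m r \<le> lac_h \<theta> r"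
  obtains A where "\<And>r. card (lac_I \<theta> r \<inter> A) = m r"
proof (rule that)
  let ?J = "\<lambda>r. {\<theta> (r - 1)<..\<theta> (r - 1) + m r}"
  fix r
  have mono: "mono \<theta>"
    using \<theta> by (simp add: lacunary_def strict_mono_mono)
  \<comment> \<open>This includes \<open>r = 0\<close>, where truncated subtraction gives
    \<open>lac_h \<theta> 0 = 0\<close> and hence \<open>m 0 = 0\<close>.\<close>
  have le: "\<theta> (r - 1) + m r \<le> \<theta> r" for r
    using m[of r] monoD[OF mono, of "r - 1" r] by (simp add: lac_h_def)
  have J: "?J r \<subseteq> lac_I \<theta> r" for r
    using le[of r] by (auto simp: lac_I_def)
  have disj: "q = r" if "k \<in> lac_I \<theta> r" "k \<in> lac_I \<theta> q" for k q
  proof (rule ccontr)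
    assume "q \<noteq> r"
    then have "r \<le> q - 1 \<or> q \<le> r - 1" by linarith
    then have "\<theta> r \<le> \<theta> (q - 1) \<or> \<theta> q \<le> \<theta> (r - 1)"
      using monoD[OF mono] by blast
    then show False using that by (auto simp: lac_I_def)
  qed
  have "lac_I \<theta> r \<inter> (\<Union>r. ?J r) = ?J r"
    using J disj by blast
  then show "card (lac_I \<theta> r \<inter> (\<Union>r. ?J r)) = m r" by simp
qed

lemma not_lac_compatible_separating:
  fixes v :: "'a::real_normed_vector"
  assumes v: "v \<noteq> 0" and f: "modulus_function f" and \<theta>: "lacunary \<theta>"
    and nc: "\<not> lac_compatible \<theta> f"
  obtains x :: "nat \<Rightarrow> 'a" where "x \<in> N_lac \<theta>" "x \<notin> S_lac_mod \<theta> f"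
proof -
  let ?h = "\<lambda>r. real (lac_h \<theta> r)"
  obtain m where m_le: "\<And>r. m r \<le> lac_h \<theta> r"
    and lim: "(\<lambda>r. 1 / ?h r * real (m r)) \<longlonglongrightarrow> 0"
    and nlim: "\<not> (\<lambda>r. 1 / f (?h r) * f (real (m r))) \<longlonglongrightarrow> 0"
    using not_lac_compatible_imp_counts[OF f \<theta> nc] by blast
  obtain A where A: "\<And>r. card (lac_I \<theta> r \<inter> A) = m r"
    using ex_set_lac_I_counts[OF \<theta> m_le] by blast
  have fin: "finite (lac_I \<theta> r)" for r by (simp add: lac_I_def)
  have compl: "card (lac_I \<theta> r - A) = lac_h \<theta> r - m r" for r
    using fin by (simp add: card_Diff_subset_Int card_lac_I A)
  have h_pos: "\<forall>\<^sub>F r in sequentially. ?h r > 0"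
    using filterlim_lac_h[OF \<theta>] unfolding filterlim_at_top_dense by blast
  define x where "x k = (if k \<in> A then v else 0)" for k
  have "(\<Sum>k\<in>lac_I \<theta> r. norm (x k - 0)) = norm v * real (m r)" for r
  proof -
    have "(\<Sum>k\<in>lac_I \<theta> r. norm (x k - 0)) = (\<Sum>k\<in>lac_I \<theta> r. if k \<in> A then norm v else 0)"
      by (intro sum.cong) (auto simp: x_def)
    also have "\<dots> = (\<Sum>k\<in>lac_I \<theta> r \<inter> A. norm v)"
      by (rule sum.inter_restrict[OF fin, symmetric])
    finally show ?thesis by (simp add: A)
  qed
  moreover have "(\<lambda>r. 1 / ?h r * (norm v * real (m r))) \<longlonglongrightarrow> 0"
    using tendsto_mult_left[OF lim, of "norm v"] by (simp add: algebra_simps)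
  ultimately have "(\<lambda>r. 1 / ?h r * (\<Sum>k\<in>lac_I \<theta> r. norm (x k - 0))) \<longlonglongrightarrow> 0"
    by simp
  then have N: "x \<in> N_lac \<theta>" unfolding N_lac_def by blast
  have S: "x \<notin> S_lac_mod \<theta> f"
  proof
    assume "x \<in> S_lac_mod \<theta> f"
    then obtain L where L: "\<And>\<epsilon>. \<epsilon> > 0 \<Longrightarrow>
      (\<lambda>r. 1 / f (?h r) * f (real (card {k \<in> lac_I \<theta> r. norm (x k - L) > \<epsilon>}))) \<longlonglongrightarrow> 0"
      unfolding S_lac_mod_def by blast
    show False
    proof (cases "L = 0")
      case True
      \<comment> \<open>With limit 0, the threshold \<open>norm v / 2\<close> separates the two
        values of \<open>x\<close>, so the exceptional indices are exactly those in
        \<open>A\<close>.\<close>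
      have "{k \<in> lac_I \<theta> r. norm (x k - L) > norm v / 2} = lac_I \<theta> r \<inter> A" for r
        using v True by (auto simp: x_def split: if_splits)
      with L[of "norm v / 2"] v nlim show False by (simp add: A)
    next
      case False
      \<comment> \<open>Off \<open>A\<close> the entries are 0, at distance \<open>norm L\<close>
        from \<open>L\<close>, and eventually they fill at least half of
        \<open>lac_I \<theta> r\<close>. Comparison then forces a ratio that is eventually 1 to tend
        to 0.\<close>
      have "(\<lambda>r. 1 / f (?h r) * f (?h r)) \<longlonglongrightarrow> 0"
      proof (rule modulus_ratio_tendsto_0[OF f _ L[of "norm L / 2"], of "1 / 2"])
        show "norm L / 2 > 0" using False by simp
        have "\<forall>\<^sub>F r in sequentially. 1 / ?h r * real (m r) < 1 / 2"
          by (rule order_tendstoD(2)[OF lim]) simp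
        then show "\<forall>\<^sub>F r in sequentially.
          1 / 2 * ?h r \<le> real (card {k \<in> lac_I \<theta> r. norm (x k - L) > norm L / 2})"
          using h_pos
        proof eventually_elim
          case (elim r)
          have "lac_I \<theta> r - A \<subseteq> {k \<in> lac_I \<theta> r. norm (x k - L) > norm L / 2}"
            using False by (auto simp: x_def)
          then have "card (lac_I \<theta> r - A) \<le> card {k \<in> lac_I \<theta> r. norm (x k - L) > norm L / 2}"
            using fin by (intro card_mono) auto
          moreover have "1 / 2 * ?h r \<le> real (card (lac_I \<theta> r - A))"
            using elim m_le[of r] by (simp add: compl of_nat_diff field_simps)
          ultimately show ?case by linarith
        qed
      qed auto
      moreover have "\<forall>\<^sub>F r in sequentially. 1 / f (?h r) * f (?h r) = 1"
        using h_pos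
      proof eventually_elim
        case (elim r)
        show ?case using modulus_pos[OF f elim] by simp
      qed
      ultimately have "(\<lambda>r. 1 :: real) \<longlonglongrightarrow> 0"
        by (rule Lim_transform_eventually)
      then show False by (simp add: LIMSEQ_const_iff)
    qed
  qed
  from N S show thesis by (rule that)
qed

text \<open>Over the zero space all four sets contain every sequence, whatever \<open>f\<close> is,
  so equality would say nothing about \<open>f\<close>; hence \<open>nontrivial\<close>, which
  supplies the vector \<open>v\<close>.\<close>

theorem theorem3p4:
  fixes f :: "real \<Rightarrow> real" and \<theta> :: "nat \<Rightarrow> nat"
  assumes nontrivial: "(UNIV :: 'a::real_normed_vector set) \<noteq> {0}"
    and modulus: "unbounded_modulus f"
    and lacunary: "lacunary \<theta>"
  shows "((S_lac \<theta> :: (nat \<Rightarrow> 'a) set) = S_lac_mod \<theta> f \<longrightarrow> lac_compatible \<theta> f) \<and>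
         ((N_lac \<theta> :: (nat \<Rightarrow> 'a) set) = N_lac_mod \<theta> f \<longrightarrow> lac_compatible \<theta> f)"
proof -
  have f: "modulus_function f" using modulus by (simp add: unbounded_modulus_def)
  obtain v :: 'a where v: "v \<noteq> 0" using nontrivial by blast
  have "(S_lac \<theta> :: (nat \<Rightarrow> 'a) set) \<noteq> S_lac_mod \<theta> f \<and>
        (N_lac \<theta> :: (nat \<Rightarrow> 'a) set) \<noteq> N_lac_mod \<theta> f" if nc: "\<not> lac_compatible \<theta> f"
  proof -
    obtain x :: "nat \<Rightarrow> 'a" where "x \<in> N_lac \<theta>" "x \<notin> S_lac_mod \<theta> f"
      using not_lac_compatible_separating[OF v f lacunary nc] by blast
    \<comment> \<open>By the two inclusions, \<open>x\<close> lies in both sets without a modulus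
      and in neither set with one.\<close>
    then show ?thesis
      using N_lac_subset_S_lac[of \<theta>] N_lac_mod_subset_S_lac_mod[OF f, of \<theta>] by blast
  qed
  then show ?thesis by blast
qed

end
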